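(* Fix integers $r\geq 2$ and $t\geq 1$. Let $G$ be an $r$-uniform hypergraph and let $V_1,\dots,V_n$ be a partition of $V(G)$ such that, for each $i\in\{1,\dots,n\}$, $|V_i|\geq t$ and at most $r^{-r}(r-1)^{r-1}t^{r-1}|V_i|$ stretched edges of $G$ intersect $V_i$. Then there exist at least $\left(\frac{r-1}{r}t\right)^n$ independent transversals of $V_1,\dots,V_n$.
   Context: Hypergraphs are finite; a hypergraph $G$ has vertex set $V(G)$ and a set $E(G)$ of edges, each a subset of $V(G)$; $G$ is $r$-uniform if each edge has exactly $r$ vertices. A set $X\subseteq V(G)$ is independent if no edge of $G$ is a subset of $X$. A transversal of a partition $V_1,\dots,V_n$ of $V(G)$ is a set $X$ with $|X\cap V_i|=1$ for each $i$. An edge $e$ is stretched by $V_1,\dots,V_n$ if its vertices lie in $|e|$ distinct parts (i.e. $|e\cap V_i|\leq 1$ for all $i$). *)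

theory Defs
  imports Complex_Main "HOL-Library.Disjoint_Sets"
begin

definition hypergraph :: "'a set \<Rightarrow> 'a set set \<Rightarrow> bool" where
  "hypergraph V E \<longleftrightarrow> finite V \<and> (\<forall>e\<in>E. e \<subseteq> V)"

definition uniform_hypergraph :: "nat \<Rightarrow> 'a set \<Rightarrow> 'a set set \<Rightarrow> bool" where
  "uniform_hypergraph r V E \<longleftrightarrow> hypergraph V E \<and> (\<forall>e\<in>E. card e = r)"

definition independent_set :: "'a set \<Rightarrow> 'a set set \<Rightarrow> 'a set \<Rightarrow> bool" where
  "independent_set V E X \<longleftrightarrow> X \<subseteq> V \<and> \<not> (\<exists>e\<in>E. e \<subseteq> X)"

text \<open>The parts are given by a family \<open>P\<close> of which only the values
  \<open>P 1, \<dots>, P n\<close> matter; elsewhere \<open>P\<close> is arbitrary.\<close>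

definition indexed_partition :: "'a set \<Rightarrow> nat \<Rightarrow> (nat \<Rightarrow> 'a set) \<Rightarrow> bool" where
  "indexed_partition V n P \<longleftrightarrow>
     (\<forall>i\<in>{1..n}. P i \<noteq> {}) \<and> disjoint_family_on P {1..n} \<and> (\<Union>i\<in>{1..n}. P i) = V"

definition transversal :: "'a set \<Rightarrow> nat \<Rightarrow> (nat \<Rightarrow> 'a set) \<Rightarrow> 'a set \<Rightarrow> bool" where
  "transversal V n P X \<longleftrightarrow> X \<subseteq> V \<and> (\<forall>i\<in>{1..n}. card (X \<inter> P i) = 1)"

definition stretched :: "nat \<Rightarrow> (nat \<Rightarrow> 'a set) \<Rightarrow> 'a set \<Rightarrow> bool" where
  "stretched n P e \<longleftrightarrow> (\<forall>i\<in>{1..n}. card (e \<inter> P i) \<le> 1)"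

end

theory Submission
  imports Defs
begin

text \<open>The proof is Rosenfeld's counting argument. Let \<open>a S\<close> be the number of independent
  transversals of the parts indexed by \<open>S\<close>, and put \<open>\<beta> = (r - 1) t / r\<close>. By induction on the
  size of \<open>S\<close>, adding one part \<open>P i\<close> multiplies \<open>a S\<close> by at least \<open>\<beta>\<close>: of the
  \<open>card (P i) * a S\<close> one-point extensions, those spoiled by a fixed edge \<open>e\<close> through \<open>P i\<close> are
  determined by an independent transversal of the parts missed by \<open>e\<close>, so by the induction
  hypothesis there are at most \<open>a S / \<beta>^(r - 1)\<close> of them. The degree condition enters only as
  \<open>deg (P i) \<le> (card (P i) - \<beta>) \<beta>^(r - 1)\<close>.\<close>

section \<open>Independent transversals of subfamilies of the parts\<close>

locale partitioned_hypergraph =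
  fixes I :: "'i set" and P :: "'i \<Rightarrow> 'a set" and E :: "'a set set" and r :: nat
  assumes finite_index: "finite I"
    and finite_part: "i \<in> I \<Longrightarrow> finite (P i)"
    and disjoint_parts: "disjoint_family_on P I"
    and edge_subset: "e \<in> E \<Longrightarrow> e \<subseteq> \<Union>(P ` I)"
    and card_edge: "e \<in> E \<Longrightarrow> card e = r"
    and uniformity_pos: "0 < r"
begin

text \<open>\<open>E\<close> is not restricted to the parts in \<open>S\<close>: an edge leaving
  their union cannot lie inside \<open>X\<close> anyway.\<close>

definition indep_transversals :: "'i set \<Rightarrow> 'a set set" where
  "indep_transversals S =
     {X. X \<subseteq> \<Union>(P ` S) \<and> (\<forall>i\<in>S. card (X \<inter> P i) = 1) \<and> \<not> (\<exists>e\<in>E. e \<subseteq> X)}"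

text \<open>Stretching refers to all of \<open>I\<close> rather than to a current subfamily, so one
  degree bound serves every stage of the induction.\<close>

definition stretched_edges_at :: "'i \<Rightarrow> 'a set set" where
  "stretched_edges_at i = {e \<in> E. (\<forall>j\<in>I. card (e \<inter> P j) \<le> 1) \<and> e \<inter> P i \<noteq> {}}"

definition extensions :: "'i \<Rightarrow> 'i set \<Rightarrow> 'a set set" where
  "extensions i S = (\<lambda>(v, X). insert v X) ` (P i \<times> indep_transversals S)"

lemma finite_Union_parts: "S \<subseteq> I \<Longrightarrow> finite (\<Union>(P ` S))"
  using finite_index finite_part by (meson finite_UN_I finite_subset subsetD)

lemma finite_indep_transversals: "S \<subseteq> I \<Longrightarrow> finite (indep_transversals S)"
  by (rule finite_subset[of _ "Pow (\<Union>(P ` S))"])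
     (auto simp: indep_transversals_def finite_Union_parts)

lemma finite_stretched_edges_at: "finite (stretched_edges_at i)"
  by (rule finite_subset[of _ "Pow (\<Union>(P ` I))"])
     (use edge_subset in \<open>auto simp: stretched_edges_at_def finite_Union_parts\<close>)

lemma parts_disjoint: "i \<in> I \<Longrightarrow> j \<in> I \<Longrightarrow> i \<noteq> j \<Longrightarrow> P i \<inter> P j = {}"
  using disjoint_parts by (simp add: disjoint_family_on_def)

lemma indep_transversals_empty: "indep_transversals {} = {{}}"
proof -
  have "{} \<notin> E"
    using card_edge uniformity_pos by force
  then show ?thesis
    by (auto simp: indep_transversals_def)
qed

section \<open>One-point extensions and the edges that spoil them\<close>

context
  fixes i :: 'i and S :: "'i set"
  assumes i: "i \<in> I" "i \<notin> S" and S: "S \<subseteq> I"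
begin

lemma indep_transversals_disjoint_part:
  assumes "X \<in> indep_transversals S"
  shows "X \<inter> P i = {}"
proof -
  have "P j \<inter> P i = {}" if "j \<in> S" for j
    using i S that by (intro parts_disjoint) auto
  then have "\<Union>(P ` S) \<inter> P i = {}"
    by blast
  moreover have "X \<subseteq> \<Union>(P ` S)"
    using assms by (simp add: indep_transversals_def)
  ultimately show ?thesis
    by blast
qed

text \<open>Since \<open>X\<close> misses \<open>P i\<close>, the added vertex is recovered as the
  only point of the extension in \<open>P i\<close>, so no set arises from two pairs.\<close>

lemma card_extensions: "card (extensions i S) = card (P i) * card (indep_transversals S)"
proof -
  have "inj_on (\<lambda>(v, X). insert v X) (P i \<times> indep_transversals S)"
  proof (rule inj_onI, clarify)
    fix v X w Y
    assume v: "v \<in> P i" "w \<in> P i" and X: "X \<in> indep_transversals S" "Y \<in> indep_transversals S"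
      and eq: "insert v X = insert w Y"
    have dis: "X \<inter> P i = {}" "Y \<inter> P i = {}"
      using X by (simp_all add: indep_transversals_disjoint_part)
    have "insert v X \<inter> P i = {v}" "insert w Y \<inter> P i = {w}"
      using v dis by auto
    then have "v = w"
      using eq by simp
    moreover have "v \<notin> X" "w \<notin> Y"
      using v dis by auto
    ultimately show "v = w \<and> X = Y"
      using eq by (simp add: insert_ident)
  qed
  then show ?thesis
    by (simp add: extensions_def card_image card_cartesian_product)
qed

lemma extensions_transversal:
  assumes "Y \<in> extensions i S"
  shows "Y \<subseteq> \<Union>(P ` insert i S)" "j \<in> insert i S \<Longrightarrow> card (Y \<inter> P j) = 1"
    "Y - P i \<in> indep_transversals S"
proof -
  obtain v X where v: "v \<in> P i" and X: "X \<in> indep_transversals S" and Y: "Y = insert v X"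
    using assms by (auto simp: extensions_def)
  have dis: "X \<inter> P i = {}"
    using X by (rule indep_transversals_disjoint_part)
  show "Y \<subseteq> \<Union>(P ` insert i S)"
    using v X Y by (auto simp: indep_transversals_def)
  have "Y - P i = X"
    using v Y dis by auto
  with X show "Y - P i \<in> indep_transversals S"
    by simp
  show "card (Y \<inter> P j) = 1" if "j \<in> insert i S"
  proof (cases "j = i")
    case True
    then have "Y \<inter> P j = {v}"
      using v Y dis by auto
    then show ?thesis by simp
  next
    case False
    then have "j \<in> S" using that by simp
    then have "v \<notin> P j"
      using False v parts_disjoint[of i j] i S by blast
    then have "Y \<inter> P j = X \<inter> P j"
      using Y by auto
    then show ?thesis
      using X \<open>j \<in> S\<close> by (simp add: indep_transversals_def)
  qed
qed

text \<open>An edge inside an extension \<open>Y\<close> meets \<open>P i\<close>, because deleting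
  \<open>P i\<close> leaves an independent set. It is stretched, because \<open>Y\<close> has one
  vertex in each part of \<open>insert i S\<close> and none in the others.\<close>

lemma extensions_subset:
  "extensions i S \<subseteq> indep_transversals (insert i S) \<union>
     (\<Union>e\<in>stretched_edges_at i. {Y \<in> extensions i S. e \<subseteq> Y})"
proof
  fix Y assume Y: "Y \<in> extensions i S"
  note tr = extensions_transversal[OF Y]
  show "Y \<in> indep_transversals (insert i S) \<union>
     (\<Union>e\<in>stretched_edges_at i. {Y \<in> extensions i S. e \<subseteq> Y})"
  proof (cases "\<exists>e\<in>E. e \<subseteq> Y")
    case False
    then show ?thesis
      using tr by (auto simp: indep_transversals_def)
  next
    case True
    then obtain e where e: "e \<in> E" "e \<subseteq> Y" by auto
    have "card (e \<inter> P j) \<le> 1" if "j \<in> I" for j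
    proof (cases "j \<in> insert i S")
      case True
      then have "card (Y \<inter> P j) = 1" by (rule tr)
      moreover have "finite (Y \<inter> P j)"
        using finite_part that by blast
      ultimately show ?thesis
        using e card_mono[of "Y \<inter> P j" "e \<inter> P j"] by auto
    next
      case False
      then have "P j \<inter> P k = {}" if "k \<in> insert i S" for k
        using \<open>j \<in> I\<close> i S that by (intro parts_disjoint) auto
      then have "e \<inter> P j = {}"
        using tr(1) e by blast
      then show ?thesis by simp
    qed
    moreover have "e \<inter> P i \<noteq> {}"
      using e tr(3) by (auto simp: indep_transversals_def)
    ultimately have "e \<in> stretched_edges_at i"
      using e by (simp add: stretched_edges_at_def)
    then show ?thesis
      using Y e by auto
  qed
qed

text \<open>If \<open>e\<close> meets a part, it contains the only vertex of \<open>Y\<close> there,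
  so removing \<open>e\<close> from \<open>Y\<close> empties that part.\<close>

lemma edge_extension_inter:
  assumes Y: "Y \<in> extensions i S" and e: "e \<subseteq> Y" and j: "j \<in> insert i S" "e \<inter> P j \<noteq> {}"
  shows "Y \<inter> P j = e \<inter> P j"
proof -
  obtain y where "Y \<inter> P j = {y}"
    using extensions_transversal(2)[OF Y j(1)] by (auto simp: card_1_singleton_iff)
  moreover have "e \<inter> P j \<subseteq> Y \<inter> P j"
    using e by blast
  ultimately show ?thesis
    using j(2) by (metis subset_singletonD)
qed

text \<open>\<open>e\<close> is the disjoint union of its traces on these parts, and each trace is a
  single vertex. The count supplies the exponent \<open>r - 1\<close> once \<open>P i\<close> is set
  aside.\<close>

lemma card_edge_parts:
  assumes Y: "Y \<in> extensions i S" and e: "e \<in> E" "e \<subseteq> Y"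
  shows "card {j \<in> insert i S. e \<inter> P j \<noteq> {}} = r"
proof -
  let ?J = "{j \<in> insert i S. e \<inter> P j \<noteq> {}}"
  have J: "?J \<subseteq> I" using i S by auto
  have "e \<subseteq> (\<Union>j\<in>?J. e \<inter> P j)"
  proof
    fix x assume x: "x \<in> e"
    then have "x \<in> \<Union>(P ` insert i S)"
      using e(2) extensions_transversal(1)[OF Y] by (meson subsetD)
    then obtain j where "j \<in> insert i S" "x \<in> e \<inter> P j"
      using x by blast
    then show "x \<in> (\<Union>j\<in>?J. e \<inter> P j)"
      by (intro UN_I[of j]) auto
  qed
  then have "e = (\<Union>j\<in>?J. e \<inter> P j)"
    by (intro equalityI UN_least Int_lower1)
  then have "r = card (\<Union>j\<in>?J. e \<inter> P j)"
    using card_edge[OF e(1)] by simp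
  also have "\<dots> = (\<Sum>j\<in>?J. card (e \<inter> P j))"
  proof (rule card_UN_disjoint)
    show "finite ?J" using J finite_index by (rule finite_subset)
    show "\<forall>j\<in>?J. finite (e \<inter> P j)" using J finite_part by blast
    show "\<forall>j\<in>?J. \<forall>k\<in>?J. j \<noteq> k \<longrightarrow> e \<inter> P j \<inter> (e \<inter> P k) = {}"
    proof (intro ballI impI)
      fix j k assume "j \<in> ?J" "k \<in> ?J" "j \<noteq> k"
      with J have "P j \<inter> P k = {}"
        by (intro parts_disjoint) auto
      then show "e \<inter> P j \<inter> (e \<inter> P k) = {}"
        by blast
    qed
  qed
  also have "\<dots> = (\<Sum>j\<in>?J. 1)"
  proof (rule sum.cong[OF refl])
    fix j assume "j \<in> ?J"
    then show "card (e \<inter> P j) = 1"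
      using edge_extension_inter[OF Y e(2), of j] extensions_transversal(2)[OF Y, of j] by auto
  qed
  finally show ?thesis by simp
qed

text \<open>Deleting \<open>e\<close> is injective on the sets containing \<open>e\<close>, and what
  remains meets exactly the parts of \<open>S\<close> missed by \<open>e\<close>.\<close>

lemma card_extensions_containing_edge:
  assumes e: "e \<inter> P i \<noteq> {}"
  shows "card {Y \<in> extensions i S. e \<subseteq> Y}
           \<le> card (indep_transversals (S - {j \<in> insert i S. e \<inter> P j \<noteq> {}}))"
proof (rule card_inj_on_le)
  let ?J = "{j \<in> insert i S. e \<inter> P j \<noteq> {}}"
  show "inj_on (\<lambda>Y. Y - e) {Y \<in> extensions i S. e \<subseteq> Y}"
    by (rule inj_onI) auto
  show "finite (indep_transversals (S - ?J))"
    using S by (intro finite_indep_transversals) auto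
  show "(\<lambda>Y. Y - e) ` {Y \<in> extensions i S. e \<subseteq> Y} \<subseteq> indep_transversals (S - ?J)"
  proof clarify
    fix Y assume Y: "Y \<in> extensions i S" and eY: "e \<subseteq> Y"
    note tr = extensions_transversal[OF Y]
    note inter = edge_extension_inter[OF Y eY]
    have "Y - e \<subseteq> \<Union>(P ` (S - ?J))"
    proof
      fix y assume y: "y \<in> Y - e"
      then obtain j where j: "j \<in> insert i S" "y \<in> P j"
        using tr(1) by blast
      have "e \<inter> P j = {}"
        using inter[OF j(1)] y j by blast
      then show "y \<in> \<Union>(P ` (S - ?J))"
        using j e by auto
    qed
    moreover have "card ((Y - e) \<inter> P j) = 1" if "j \<in> S - ?J" for j
    proof -
      have "(Y - e) \<inter> P j = Y \<inter> P j"
        using that by auto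
      then show ?thesis
        using tr(2)[of j] that by simp
    qed
    \<comment> \<open>The vertex of \<open>Y\<close> in \<open>P i\<close> disappears with
      \<open>e\<close>, so independence is inherited from the transversal that was extended.\<close>
    moreover have "Y - e \<subseteq> Y - P i"
      using inter[of i] e by auto
    then have "\<not> (\<exists>f\<in>E. f \<subseteq> Y - e)"
      using tr(3) by (fastforce simp: indep_transversals_def)
    ultimately show "Y - e \<in> indep_transversals (S - ?J)"
      unfolding indep_transversals_def by blast
  qed
qed

end

section \<open>Growth by a factor \<open>\<beta>\<close> per part\<close>

text \<open>Putting the parts of \<open>J\<close> back one at a time gains a factor of at least
  \<open>\<beta>\<close> each. The growth step is assumed only inside \<open>S\<close>, so that an
  induction hypothesis about proper subsets of \<open>S\<close> can supply it.\<close>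

lemma card_indep_transversals_remove:
  fixes \<beta> :: real
  assumes \<beta>: "0 < \<beta>"
    and step: "\<And>i U. i \<in> I \<Longrightarrow> i \<notin> U \<Longrightarrow> insert i U \<subseteq> S \<Longrightarrow>
      \<beta> * card (indep_transversals U) \<le> card (indep_transversals (insert i U))"
    and S: "S \<subseteq> I" and J: "J \<subseteq> S"
  shows "\<beta> ^ card J * card (indep_transversals (S - J)) \<le> card (indep_transversals S)"
proof -
  have "finite J"
    using S J finite_index by (meson finite_subset)
  then show ?thesis
    using J
  proof (induction J rule: finite_induct)
    case empty
    then show ?case by simp
  next
    case (insert j J)
    have *: "insert j (S - insert j J) = S - J"
      using insert by auto
    have "\<beta> * card (indep_transversals (S - insert j J)) \<le> card (indep_transversals (S - J))"
      using step[of j "S - insert j J"] insert.prems S unfolding * by auto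
    then have "\<beta> ^ card J * (\<beta> * card (indep_transversals (S - insert j J)))
        \<le> \<beta> ^ card J * card (indep_transversals (S - J))"
      using \<beta> by (intro mult_left_mono) auto
    also have "\<dots> \<le> card (indep_transversals S)"
      using insert by simp
    finally show ?case
      using insert.hyps by (simp add: mult_ac)
  qed
qed

text \<open>Strong induction on \<open>S\<close>, for all \<open>i\<close> at once: bounding the
  spoiled extensions needs the growth step for other parts over smaller index sets.\<close>

lemma card_indep_transversals_insert:
  fixes \<beta> :: real
  assumes \<beta>: "0 < \<beta>"
    and deg: "\<And>i. i \<in> I \<Longrightarrow>
      real (card (stretched_edges_at i)) \<le> (real (card (P i)) - \<beta>) * \<beta> ^ (r - 1)"
    and iS: "i \<in> I" "i \<notin> S" "S \<subseteq> I"
  shows "\<beta> * card (indep_transversals S) \<le> card (indep_transversals (insert i S))"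
proof -
  have "finite S"
    using iS(3) finite_index by (rule finite_subset)
  then show ?thesis
    using iS
  proof (induction S arbitrary: i rule: finite_psubset_induct)
    case (psubset S)
    note i = psubset.prems(1,2) and S = psubset.prems(3)
    let ?a = "\<lambda>S. real (card (indep_transversals S))"
    let ?B = "\<lambda>e. {Y \<in> extensions i S. e \<subseteq> Y}"
    have remove: "\<beta> ^ card J * ?a (S - J) \<le> ?a S" if "J \<subseteq> S" for J
    proof (rule card_indep_transversals_remove[OF \<beta> _ S that])
      fix k U assume "k \<in> I" "k \<notin> U" "insert k U \<subseteq> S"
      then show "\<beta> * ?a U \<le> ?a (insert k U)"
        using psubset.IH[of U k] S by blast
    qed
    have bad: "card (?B e) * \<beta> ^ (r - 1) \<le> ?a S" if e: "e \<in> stretched_edges_at i" for e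
    \<comment> \<open>An edge reaching beyond \<open>insert i S\<close> lies in no extension and may
      meet fewer than \<open>r\<close> of these parts, so counting the parts requires a member of
      \<open>?B e\<close>.\<close>
    proof (cases "?B e = {}")
      case True
      then show ?thesis by (simp only: card.empty of_nat_0)
    next
      case False
      then obtain Y where Y: "Y \<in> extensions i S" "e \<subseteq> Y" by auto
      let ?J = "{j \<in> insert i S. e \<inter> P j \<noteq> {}}"
      have e': "e \<in> E" "e \<inter> P i \<noteq> {}"
        using e by (auto simp: stretched_edges_at_def)
      have "card ?J = r"
        using card_edge_parts[OF i S Y(1) e'(1) Y(2)] .
      moreover have "i \<in> ?J" using e' by simp
      \<comment> \<open>As \<open>i\<close> is not in \<open>S\<close>, deleting the parts met by
        \<open>e\<close> removes only \<open>r - 1\<close> parts from \<open>S\<close>.\<close>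
      ultimately have cJ: "card (?J - {i}) = r - 1"
        by (simp add: card_Diff_singleton)
      have SJ: "S - (?J - {i}) = S - ?J"
        using i by auto
      have "real (card (?B e)) \<le> ?a (S - ?J)"
        using card_extensions_containing_edge[OF i S e'(2)] by simp
      then have "card (?B e) * \<beta> ^ (r - 1) \<le> \<beta> ^ (r - 1) * ?a (S - ?J)"
        using \<beta> by (simp add: mult.commute)
      also have "\<dots> \<le> ?a S"
        using remove[of "?J - {i}"] unfolding cJ SJ by auto
      finally show ?thesis .
    qed
    have fin: "finite (indep_transversals (insert i S))"
      using i S by (intro finite_indep_transversals) auto
    have finX: "finite (extensions i S)"
      using finite_part[OF i(1)] finite_indep_transversals[OF S] by (simp add: extensions_def)
    have "card (extensions i S)
        \<le> card (indep_transversals (insert i S) \<union> (\<Union>e\<in>stretched_edges_at i. ?B e))"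
      using fin finX finite_stretched_edges_at extensions_subset[OF i S]
      by (intro card_mono) auto
    also have "\<dots> \<le> card (indep_transversals (insert i S)) + card (\<Union>e\<in>stretched_edges_at i. ?B e)"
      by (rule card_Un_le)
    also have "card (\<Union>e\<in>stretched_edges_at i. ?B e) \<le> (\<Sum>e\<in>stretched_edges_at i. card (?B e))"
      by (rule card_UN_le[OF finite_stretched_edges_at])
    finally have count:
      "card (P i) * ?a S \<le> ?a (insert i S) + (\<Sum>e\<in>stretched_edges_at i. real (card (?B e)))"
      unfolding card_extensions[OF i S]
      by (simp flip: of_nat_mult of_nat_sum of_nat_add)
    have "(\<Sum>e\<in>stretched_edges_at i. real (card (?B e)))
        \<le> (\<Sum>e\<in>stretched_edges_at i. ?a S / \<beta> ^ (r - 1))"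
      using bad \<beta> by (intro sum_mono) (simp add: pos_le_divide_eq)
    also have "\<dots> = card (stretched_edges_at i) * (?a S / \<beta> ^ (r - 1))"
      by simp
    \<comment> \<open>The degree condition is shaped so that, of all
      \<open>card (P i) * ?a S\<close> extensions, at least \<open>\<beta> * ?a S\<close>
      survive.\<close>
    also have "\<dots> \<le> (card (P i) - \<beta>) * \<beta> ^ (r - 1) * (?a S / \<beta> ^ (r - 1))"
      using deg[OF i(1)] \<beta> by (intro mult_right_mono) auto
    also have "\<dots> = (card (P i) - \<beta>) * ?a S"
      using \<beta> by simp
    finally show ?case
      using count by (simp add: algebra_simps)
  qed
qed

text \<open>Start from the empty family, whose one transversal is independent because edges are
  nonempty, and add all parts.\<close>

theorem card_indep_transversals_ge:
  fixes \<beta> :: real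
  assumes \<beta>: "0 < \<beta>"
    and deg: "\<And>i. i \<in> I \<Longrightarrow>
      real (card (stretched_edges_at i)) \<le> (real (card (P i)) - \<beta>) * \<beta> ^ (r - 1)"
  shows "\<beta> ^ card I \<le> card (indep_transversals I)"
proof -
  have "\<beta> ^ card I * card (indep_transversals (I - I)) \<le> card (indep_transversals I)"
    using card_indep_transversals_insert[OF \<beta> deg]
    by (intro card_indep_transversals_remove[OF \<beta>]) auto
  then show ?thesis
    by (simp add: indep_transversals_empty)
qed

end

section \<open>Choice of \<open>\<beta>\<close> and the numerical condition\<close>

theorem theorem9:
  fixes r t n :: nat
    and V :: "'a set"
    and E :: "'a set set"
    and P :: "nat \<Rightarrow> 'a set"
  assumes "r \<ge> 2"
    and "t \<ge> 1"
    and "uniform_hypergraph r V E"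
    and "indexed_partition V n P"
    and "\<And>i. i \<in> {1..n} \<Longrightarrow> card (P i) \<ge> t"
    and "\<And>i. i \<in> {1..n} \<Longrightarrow>
           real (card {e \<in> E. stretched n P e \<and> e \<inter> P i \<noteq> {}})
             \<le> 1 / real r ^ r * (real r - 1) ^ (r - 1) * real t ^ (r - 1) * real (card (P i))"
  shows "real (card {X. transversal V n P X \<and> independent_set V E X})
           \<ge> ((real r - 1) / real r * real t) ^ n"
proof -
  \<comment> \<open>For a part of size \<open>t\<close>, this value maximises
    \<open>(t - \<beta>) * \<beta> ^ (r - 1)\<close>, and the maximum is exactly the number of
    stretched edges allowed.\<close>
  define \<beta> where "\<beta> = (real r - 1) / real r * real t"
  have V: "(\<Union>i\<in>{1..n}. P i) = V" "finite V"
    using assms(3,4) by (auto simp: indexed_partition_def uniform_hypergraph_def hypergraph_def)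
  interpret partitioned_hypergraph "{1..n}" P E r
  proof
    show "finite (P i)" if "i \<in> {1..n}" for i
      using that V by (metis UN_upper finite_subset)
    show "disjoint_family_on P {1..n}"
      using assms(4) by (simp add: indexed_partition_def)
  qed (use assms(1,3) V in \<open>auto simp: uniform_hypergraph_def hypergraph_def\<close>)
  have \<beta>: "0 < \<beta>"
    using assms(1,2) by (simp add: \<beta>_def)
  have "real (card (stretched_edges_at i)) \<le> (real (card (P i)) - \<beta>) * \<beta> ^ (r - 1)"
    if i: "i \<in> {1..n}" for i
  proof -
    have "stretched_edges_at i = {e \<in> E. stretched n P e \<and> e \<inter> P i \<noteq> {}}"
      unfolding stretched_edges_at_def stretched_def by simp
    then have "real (card (stretched_edges_at i))
        \<le> 1 / real r ^ r * (real r - 1) ^ (r - 1) * real t ^ (r - 1) * real (card (P i))"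
      using assms(6)[OF i] by simp
    \<comment> \<open>One of the \<open>r\<close> factors \<open>1 / r\<close> goes with
      \<open>card (P i)\<close>; the other \<open>r - 1\<close> complete
      \<open>\<beta> ^ (r - 1)\<close>.\<close>
    also have "\<dots> = real (card (P i)) / real r * \<beta> ^ (r - 1)"
      using assms(1) power_minus_mult[of r "real r"]
      by (simp add: \<beta>_def power_mult_distrib power_divide mult_ac)
    also have "\<dots> \<le> (real (card (P i)) - \<beta>) * \<beta> ^ (r - 1)"
    proof (rule mult_right_mono)
      \<comment> \<open>Here \<open>t \<le> card (P i)\<close> enters: \<open>\<beta>\<close> is at
        most the fraction \<open>(r - 1) / r\<close> of the part, leaving at least
        \<open>card (P i) / r\<close>.\<close>
      have "\<beta> \<le> (real r - 1) / real r * real (card (P i))"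
        unfolding \<beta>_def using assms(1) assms(5)[OF i] by (intro mult_left_mono) auto
      also have "\<dots> = real (card (P i)) - real (card (P i)) / real r"
        using assms(1) by (simp add: field_simps)
      finally show "real (card (P i)) / real r \<le> real (card (P i)) - \<beta>"
        by simp
    qed (use \<beta> in simp)
    finally show ?thesis .
  qed
  from card_indep_transversals_ge[OF \<beta> this]
  have "\<beta> ^ n \<le> card (indep_transversals {1..n})"
    by simp
  moreover have "indep_transversals {1..n} = {X. transversal V n P X \<and> independent_set V E X}"
    unfolding indep_transversals_def transversal_def independent_set_def V(1) by auto
  ultimately show ?thesis
    by (simp add: \<beta>_def)
qed

end
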